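(* As an identity of formal power series in $q, t_1, t_2$ (over a field of characteristic zero), \[ \sum_{n \geq 0} \sum_{\substack{j+k \geq n \\ 0\le j, k \leq n}} \frac{ (-1)^{j+k+n}\, t_1^j t_2^k\, q^{\binom{n}{2} + \binom{k+1}{2} + j^2-nj+j} \genfrac{[}{]}{0pt}{}{n}{n-j,\ n-k,\ j+k-n}_{q} }{(t_2q;q)_n\, (q;q)_n} = \frac{(-t_1q; q)_\infty}{(t_2q; q)_\infty}. \]
   Context: $(z;q)_0=1$, $(z;q)_n=\prod_{r=0}^{n-1}(1-zq^r)$ for $n>0$, and $(z;q)_\infty=\prod_{r\ge 0}(1-zq^r)$. For nonnegative integers $k_1,\dots,k_t$ with $k_1+\cdots+k_t=n$, the $q$-multinomial coefficient is $\genfrac{[}{]}{0pt}{}{n}{k_1,\dots,k_t}_q=\frac{(q;q)_n}{(q;q)_{k_1}\cdots(q;q)_{k_t}}$. *)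

theory Defs
  imports
    "HOL-Computational_Algebra.Formal_Power_Series"
    "HOL-Analysis.Infinite_Products"
begin

text \<open>
  The ring of power series in \<open>q, t1, t2\<close> over \<open>K\<close> is rendered as the iterated ring
  \<open>K[[t1]][[t2]][[q]]\<close>, with \<open>q\<close> the outermost variable. The metric that the library puts on
  \<^typ>\<open>'a fps fps fps\<close> is then the \<open>q\<close>-adic one, and convergence in it implies
  coefficientwise convergence in all three variables. The choice of the outermost variable
  matters: the library metric on an iterated power series ring treats the coefficient ring as
  discrete, and \<open>q\<close> is the variable in which all the series and products below converge.
\<close>

type_synonym 'a fps3 = "'a fps fps fps"

definition var_q :: "'a::comm_ring_1 fps3"
  where "var_q = fps_X"

definition var_t1 :: "'a::comm_ring_1 fps3"
  where "var_t1 = fps_const (fps_const fps_X)"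

definition var_t2 :: "'a::comm_ring_1 fps3"
  where "var_t2 = fps_const fps_X"

definition q_poch :: "'b::comm_ring_1 \<Rightarrow> 'b \<Rightarrow> nat \<Rightarrow> 'b"
  where "q_poch z q n = (\<Prod>r<n. 1 - z * q ^ r)"

definition q_poch_inf :: "'b::{t2_space, comm_ring_1} \<Rightarrow> 'b \<Rightarrow> 'b"
  where "q_poch_inf z q = (\<Prod>r. 1 - z * q ^ r)"

text \<open>Only meant for lists \<open>ks\<close> with sum \<open>n\<close>.\<close>

definition q_multinomial :: "'b::{comm_ring_1, inverse} \<Rightarrow> nat \<Rightarrow> nat list \<Rightarrow> 'b"
  where "q_multinomial q n ks = q_poch q q n / (\<Prod>k\<leftarrow>ks. q_poch q q k)"

text \<open>
  Division on \<^typ>\<open>'a fps\<close> is total; it is the true quotient whenever the denominator has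
  constant coefficient 1, which is the case for all the denominators that are used.
\<close>

lemma fps3_divide_cancel:
  fixes f g :: "'a::field_char_0 fps3"
  assumes "fps_nth g 0 = 1"
  shows "f / g * g = f"
proof -
  have inv1: "inverse (1 :: 'a fps fps) = 1"
    by (simp add: fps_inverse_one')
  have "inverse g = fps_right_inverse g (inverse (fps_nth g 0))"
    by (rule fps_inverse_def)
  then have "g * inverse g = 1"
    using fps_right_inverse[of g 1] by (simp only: assms inv1 mult_1)
  moreover have "f / g = f * inverse g"
    by (rule fps_divide_unit) (simp add: assms)
  ultimately show ?thesis
    by (simp add: mult.assoc mult.commute[of _ g])
qed

lemma q_poch_var_q_nth_0: "fps_nth (q_poch (z * var_q) var_q n) 0 = 1"
  by (induction n) (simp_all add: q_poch_def var_q_def)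

lemma convergent_prod_q_poch:
  fixes z :: "'a::field_char_0 fps3"
  shows "convergent_prod (\<lambda>r. 1 - (z * var_q) * var_q ^ r)"
proof -
  define P where "P n = (\<Prod>r\<le>n. 1 - (z * var_q) * var_q ^ r)" for n
  define L where "L = Abs_fps (\<lambda>m. fps_nth (P m) m)"
  have step: "fps_nth (P (Suc n)) m = fps_nth (P n) m" if "m \<le> n" for n m
  proof -
    have "P (Suc n) = P n - P n * z * fps_X ^ (Suc (Suc n))"
      by (simp add: P_def var_q_def algebra_simps)
    then show ?thesis
      using that by (simp add: fps_X_power_mult_right_nth del: power_Suc)
  qed
  have stable: "fps_nth (P n) m = fps_nth L m" if "m \<le> n" for n m
    using that by (induction n rule: dec_induct) (simp_all add: L_def step)
  have "P \<longlonglongrightarrow> L"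
  proof (rule tendsto_fpsI)
    fix m
    show "\<forall>\<^sub>F n in sequentially. fps_nth (P n) m = fps_nth L m"
      using stable by (auto simp: eventually_sequentially)
  qed
  moreover have "L \<noteq> 0"
  proof
    assume "L = 0"
    moreover have "fps_nth (P 0) 0 = 1"
      by (simp add: P_def var_q_def)
    ultimately show False
      using stable[of 0 0] by simp
  qed
  ultimately show ?thesis
    unfolding prod_defs P_def by (intro exI[of _ 0] exI[of _ L]) simp
qed

text \<open>
  The exponent of \<open>q\<close> in the series is a natural number although it contains a subtraction.
\<close>

lemma exponent_nonneg: "n * j \<le> (n choose 2) + (Suc k choose 2) + j ^ 2 + j"
proof -
  have "even (n * (n - 1))"
    by (cases n) auto
  then have "2 * (n choose 2) = n * (n - 1)"
    by (simp add: choose_two)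
  then have "2 * int (n choose 2) = int (n * (n - 1))"
    by linarith
  then have c: "2 * int (n choose 2) = int n * (int n - 1)"
    by (cases n) (simp_all add: algebra_simps)
  define d where "d = int n - int j"
  have d0: "d * (d - 1) \<ge> 0"
    by (cases "d \<le> 0") (simp_all add: mult_nonpos_nonpos)
  have "2 * (int (n choose 2) + int j ^ 2 + int j - int n * int j)
        = d * (d - 1) + int j ^ 2 + int j"
    using c by (simp add: d_def algebra_simps power2_eq_square)
  then have "int n * int j \<le> int (n choose 2) + int j ^ 2 + int j"
    using d0 by (smt (verit) of_nat_0_le_iff zero_le_power)
  then have "n * j \<le> (n choose 2) + j ^ 2 + j"
    by (metis of_nat_add of_nat_le_iff of_nat_mult of_nat_power)
  then show ?thesis by simp
qed

end

theory Submission
  imports Defs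
begin

text \<open>
  Put \<open>a = n - j\<close> and \<open>c = j + k - n\<close>. For fixed \<open>n\<close> and \<open>j\<close> the summands depend on \<open>c\<close> through
  \<open>(-1)\<^sup>c [j choose c]\<^sub>q q\<close> to the power \<open>(c choose 2) + (a + 1) c\<close>, times \<open>t2\<^sup>c\<close>. By the
  \<open>q\<close>-binomial theorem they add up to \<open>(t2 q\<^bsup>a+1\<^esup>; q)\<^sub>j\<close>, which cancels against the tail of
  \<open>(t2 q; q)\<^sub>n\<close>. What remains is the \<open>n\<close>-th term of the Cauchy product of Euler's series for
  \<open>(-t1 q; q)\<^sub>\<infinity>\<close> and Cauchy's series \<open>\<Sum>a. t2\<^sup>a q\<^bsup>a*a\<^esup> / ((q; q)\<^sub>a (t2 q; q)\<^sub>a) = 1 / (t2 q; q)\<^sub>\<infinity>\<close>.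
  Both series are \<open>q\<close>-adic limits of finite identities with coefficients \<open>[N choose k]\<^sub>q\<close>, since
  \<open>[N choose k]\<^sub>q (q; q)\<^sub>k\<close> is \<open>1\<close> modulo \<open>q\<^bsup>N-k\<^esup>\<close>; all limits are handled as congruences
  modulo \<open>q\<^bsup>N\<^esup>\<close>.
\<close>

section \<open>Finite \<open>q\<close>-Pochhammer products\<close>

lemma q_poch_0 [simp]: "q_poch z q 0 = 1"
  by (simp add: q_poch_def)

lemma q_poch_Suc: "q_poch z q (Suc n) = q_poch z q n * (1 - z * q ^ n)"
  by (simp add: q_poch_def)

lemma q_poch_add: "q_poch z q (m + n) = q_poch z q m * q_poch (z * q ^ m) q n"
  by (induction n) (simp_all add: q_poch_Suc power_add mult.assoc)

lemma q_poch_Suc_left: "q_poch z q (Suc n) = (1 - z) * q_poch (z * q) q n"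
  using q_poch_add[of z q 1 n] by (simp add: q_poch_def)

lemma dvd_q_poch_diff_1: "z dvd q_poch z q n - 1"
proof (induction n)
  case (Suc n)
  have "q_poch z q (Suc n) - 1 = (q_poch z q n - 1) - z * (q_poch z q n * q ^ n)"
    by (simp add: q_poch_Suc algebra_simps)
  with Suc show ?case
    by (metis dvd_diff dvd_triv_left)
qed simp

text \<open>Every factor beyond the first \<open>m\<close> is congruent to 1 modulo
  \<open>q ^ m\<close>.\<close>

lemma dvd_q_poch_diff:
  assumes "m \<le> n"
  shows "q ^ m dvd q_poch (z * q) q n - q_poch (z * q) q m"
proof -
  obtain l where n: "n = m + l"
    using assms le_Suc_ex by blast
  have "q_poch (z * q) q n - q_poch (z * q) q m
      = q_poch (z * q) q m * (q_poch (z * q * q ^ m) q l - 1)"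
    by (simp add: n q_poch_add[of _ _ m l] right_diff_distrib)
  moreover have "q ^ m dvd q_poch (z * q * q ^ m) q l - 1"
    using dvd_q_poch_diff_1[of "z * q * q ^ m" q l] by (rule dvd_mult_right)
  ultimately show ?thesis
    by simp
qed

section \<open>Gaussian binomials and finite identities\<close>

fun gauss_binomial :: "'a::comm_ring_1 \<Rightarrow> nat \<Rightarrow> nat \<Rightarrow> 'a" where
  "gauss_binomial q n 0 = 1"
| "gauss_binomial q 0 (Suc k) = 0"
| "gauss_binomial q (Suc n) (Suc k)
    = q ^ Suc k * gauss_binomial q n (Suc k) + gauss_binomial q n k"

lemma gauss_binomial_eq_0: "n < k \<Longrightarrow> gauss_binomial q n k = 0"
  by (induction q n k rule: gauss_binomial.induct) simp_all

text \<open>This ties the \<open>q\<close>-Pascal recursion, which makes sense in any commutative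
  ring, to the usual quotient with its denominators cleared.\<close>

lemma gauss_binomial_mult_q_poch:
  "k \<le> n \<Longrightarrow> gauss_binomial q n k * q_poch q q k * q_poch q q (n - k) = q_poch q q n"
proof (induction q n k rule: gauss_binomial.induct)
  case (3 q n k)
  have "gauss_binomial q n (Suc k) * q_poch q q (Suc k) * q_poch q q (n - k)
      = q_poch q q n * (1 - q ^ (n - k))"
  \<comment> \<open>In the boundary case \<open>k = n\<close> both sides vanish: the Gaussian
    binomial on the left, and \<open>1 - q ^ 0\<close> on the right.\<close>
  proof (cases "k < n")
    case True
    then have "q_poch q q (n - k) = q_poch q q (n - Suc k) * (1 - q ^ (n - k))"
      by (simp add: q_poch_Suc flip: Suc_diff_Suc)
    then show ?thesis
      using "3.IH"(1) True by (simp flip: mult.assoc)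
  qed (simp add: gauss_binomial_eq_0)
  moreover have "gauss_binomial q n k * q_poch q q (Suc k) * q_poch q q (n - k)
      = q_poch q q n * (1 - q ^ Suc k)"
    unfolding "3.IH"(2)[OF "3.prems"[unfolded Suc_le_mono], symmetric] q_poch_Suc[of q q k]
    by (simp add: mult_ac)
  ultimately have "gauss_binomial q (Suc n) (Suc k) * q_poch q q (Suc k) * q_poch q q (n - k)
      = q ^ Suc k * (q_poch q q n * (1 - q ^ (n - k))) + q_poch q q n * (1 - q ^ Suc k)"
    by (simp only: gauss_binomial.simps distrib_right mult.assoc)
  also have "\<dots> = q_poch q q n * (1 - q ^ Suc k * q ^ (n - k))"
    by (simp add: algebra_simps)
  also have "q ^ Suc k * q ^ (n - k) = q ^ Suc n"
    using "3.prems" by (simp flip: power_add power_Suc)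
  finally show ?case
    by (simp add: q_poch_Suc)
qed simp_all

text \<open>The \<open>q\<close>-Pascal recursion with an arbitrary weight \<open>f\<close>; it
  drives the induction in both finite identities below.\<close>

lemma sum_gauss_binomial_Suc:
  "(\<Sum>k\<le>Suc n. gauss_binomial q (Suc n) k * f k)
    = (\<Sum>k\<le>n. gauss_binomial q n k * (q ^ k * f k + f (Suc k)))"
proof -
  have "(\<Sum>k\<le>Suc n. gauss_binomial q (Suc n) k * f k)
      = f 0 + (\<Sum>k\<le>n. q ^ Suc k * gauss_binomial q n (Suc k) * f (Suc k))
        + (\<Sum>k\<le>n. gauss_binomial q n k * f (Suc k))"
    by (simp add: sum.atMost_Suc_shift distrib_right sum.distrib add.assoc del: sum.atMost_Suc)
  also have "f 0 + (\<Sum>k\<le>n. q ^ Suc k * gauss_binomial q n (Suc k) * f (Suc k))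
      = (\<Sum>k\<le>Suc n. q ^ k * gauss_binomial q n k * f k)"
    by (simp add: sum.atMost_Suc_shift del: sum.atMost_Suc)
  also have "\<dots> = (\<Sum>k\<le>n. q ^ k * gauss_binomial q n k * f k)"
    by (simp add: gauss_binomial_eq_0)
  finally show ?thesis
    by (simp add: sum.distrib distrib_left mult_ac)
qed

lemma Suc_choose_2: "Suc k choose 2 = (k choose 2) + k"
  by (simp add: numeral_2_eq_2)

text \<open>The two Pascal contributions combine to the factor \<open>1 + x\<close>, the first
  factor of the product, and leave the sum for \<open>n\<close> at \<open>x * q\<close>. Hence the
  induction varies \<open>x\<close>.\<close>

lemma q_binomial_theorem:
  "(\<Sum>k\<le>n. gauss_binomial q n k * (q ^ (k choose 2) * x ^ k)) = q_poch (- x) q n"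
proof (induction n arbitrary: x)
  case (Suc n)
  have "(\<Sum>k\<le>Suc n. gauss_binomial q (Suc n) k * (q ^ (k choose 2) * x ^ k))
      = (\<Sum>k\<le>n. (1 + x) * (gauss_binomial q n k * (q ^ (k choose 2) * (x * q) ^ k)))"
    unfolding sum_gauss_binomial_Suc
    by (intro sum.cong refl)
      (simp add: Suc_choose_2 power_add power_mult_distrib algebra_simps)
  also have "\<dots> = q_poch (- x) q (Suc n)"
    unfolding sum_distrib_left[symmetric] Suc by (simp add: q_poch_Suc_left)
  finally show ?case .
qed (simp add: numeral_2_eq_2)

text \<open>The two Pascal contributions share the product \<open>Q\<close> below; their
  coefficients \<open>1 - x * q ^ Suc k\<close> and \<open>x * q ^ Suc k\<close> add up to 1, so the
  sum for \<open>Suc n\<close> at \<open>x\<close> equals the sum for \<open>n\<close> at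
  \<open>x * q\<close>.\<close>

lemma finite_Cauchy_identity:
  "(\<Sum>k\<le>n. gauss_binomial q n k * (x ^ k * q ^ k\<^sup>2 * q_poch (x * q ^ Suc k) q (n - k))) = 1"
proof (induction n arbitrary: x)
  case (Suc n)
  have "q ^ k * (x ^ k * q ^ k\<^sup>2 * q_poch (x * q ^ Suc k) q (Suc n - k))
        + x ^ Suc k * q ^ (Suc k)\<^sup>2 * q_poch (x * q ^ Suc (Suc k)) q (Suc n - Suc k)
      = (x * q) ^ k * q ^ k\<^sup>2 * q_poch ((x * q) * q ^ Suc k) q (n - k)"
    if "k \<le> n" for k
  proof -
    have sq: "(Suc k)\<^sup>2 = k\<^sup>2 + k + Suc k"
      by (simp add: power2_eq_square)
    define Q where "Q = q_poch (x * q * q ^ Suc k) q (n - k)"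
    have "q_poch (x * q ^ Suc k) q (Suc n - k) = (1 - x * q ^ Suc k) * Q"
      using that by (simp add: Suc_diff_le q_poch_Suc_left Q_def) (simp add: mult_ac)
    moreover have "q_poch (x * q ^ Suc (Suc k)) q (Suc n - Suc k) = Q"
      by (simp add: Q_def mult_ac)
    ultimately show ?thesis
      unfolding Q_def[symmetric] sq
      by (simp only:) (simp add: power_add power_mult_distrib algebra_simps)
  qed
  then show ?case
    unfolding sum_gauss_binomial_Suc
    by (subst Suc[of "x * q", symmetric]) (intro sum.cong, auto)
qed simp

section \<open>Congruences, limits and cancellation in power series\<close>

lemma dvd_Cauchy_product_diff:
  fixes f g :: "nat \<Rightarrow> 'a::comm_ring_1"
  assumes f: "\<And>i. q ^ i dvd f i" and g: "\<And>i. q ^ i dvd g i"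
  shows "q ^ N dvd (\<Sum>i\<le>N. f i) * (\<Sum>i\<le>N. g i) - (\<Sum>n\<le>N. \<Sum>i\<le>n. f i * g (n - i))"
proof -
  let ?T = "{(i, j). i + j \<le> N}"
  have "?T \<subseteq> {..N} \<times> {..N}"
    by auto
  then have "(\<Sum>i\<le>N. f i) * (\<Sum>i\<le>N. g i) - (\<Sum>n\<le>N. \<Sum>i\<le>n. f i * g (n - i))
      = (\<Sum>(i, j)\<in>{..N} \<times> {..N} - ?T. f i * g j)"
    using sum.triangle_reindex_eq[of "\<lambda>i j. f i * g j" N]
    by (simp add: sum_product sum.cartesian_product sum_diff)
  \<comment> \<open>Outside the triangle \<open>i + j > N\<close>, while \<open>f i * g j\<close> is
    divisible by \<open>q ^ (i + j)\<close>.\<close>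
  also have "q ^ N dvd \<dots>"
  proof (rule dvd_sum)
    fix p
    assume "p \<in> {..N} \<times> {..N} - ?T"
    then obtain i j where p: "p = (i, j)" and "\<not> i + j \<le> N"
      by blast
    then have "q ^ N dvd q ^ (i + j)"
      by (intro le_imp_power_dvd) simp
    also have "\<dots> dvd f i * g j"
      unfolding power_add by (intro mult_dvd_mono f g)
    finally show "q ^ N dvd (case p of (i, j) \<Rightarrow> f i * g j)"
      by (simp add: p)
  qed
  finally show ?thesis .
qed

lemma fps_X_power_dvd_iff_nth: "fps_X ^ N dvd (f :: 'a::comm_ring_1 fps) \<longleftrightarrow> (\<forall>i<N. fps_nth f i = 0)"
proof
  assume "\<forall>i<N. fps_nth f i = 0"
  then have "f = fps_X ^ N * fps_shift N f"
    by (intro fps_ext) (simp add: fps_X_power_mult_nth)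
  then show "fps_X ^ N dvd f"
    by (rule dvdI)
qed (auto simp: dvd_def fps_X_power_mult_nth)

lemma tendsto_fps_if_dvd:
  fixes S :: "nat \<Rightarrow> 'a::comm_ring_1 fps"
  assumes "\<And>N. fps_X ^ N dvd S N - L"
  shows "S \<longlonglongrightarrow> L"
proof (rule tendsto_fpsI)
  fix i
  have "fps_nth (S N) i = fps_nth L i" if "N > i" for N
    using assms[of N] that by (simp add: fps_X_power_dvd_iff_nth)
  then show "\<forall>\<^sub>F N in sequentially. fps_nth (S N) i = fps_nth L i"
    unfolding eventually_sequentially by (intro exI[of _ "Suc i"]) simp
qed

text \<open>Constant coefficient 1 makes \<open>h\<close> a unit. This lets congruences be proved
  after clearing denominators.\<close>

lemma dvd_mult_unit_cancel:
  fixes f g h :: "'a::field_char_0 fps3"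
  assumes "f dvd g * h" and "fps_nth h 0 = 1"
  shows "f dvd g"
proof -
  have "g = (g * h) * (1 / h)"
    using fps3_divide_cancel[OF assms(2), of 1] by (simp add: mult_ac)
  with assms(1) show ?thesis
    by (metis dvd_mult2)
qed

lemma mult_unit_cancel:
  fixes f g h :: "'a::field_char_0 fps3"
  assumes "f * h = g * h" and "fps_nth h 0 = 1"
  shows "f = g"
proof -
  from assms(2) have "h \<noteq> 0"
    by auto
  with assms(1) show ?thesis
    by simp
qed

text \<open>With \<open>k = n - j + c\<close> the exponent splits into the Euler exponent for
  \<open>j\<close>, the Cauchy exponent for \<open>n - j\<close>, and the part depending on
  \<open>c\<close> that the \<open>q\<close>-binomial theorem absorbs.\<close>

lemma exponent_eq:
  assumes "j \<le> n" "c \<le> j"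
  shows "(n choose 2) + (Suc (n - j + c) choose 2) + j\<^sup>2 + j - n * j
    = (Suc j choose 2) + (n - j)\<^sup>2 + (c choose 2) + Suc (n - j) * c"
proof -
  obtain a where n: "n = j + a"
    using assms(1) le_Suc_ex by blast
  have add: "(u + v) choose 2 = (u choose 2) + (v choose 2) + u * v" for u v :: nat
    by (induction v) (simp_all add: Suc_choose_2)
  \<comment> \<open>Expressing squares by binomials exhibits \<open>n * j\<close> as part of what it
    is subtracted from, so the natural subtraction is exact.\<close>
  have sq: "u * u = 2 * (u choose 2) + u" for u :: nat
    by (induction u) (simp_all add: Suc_choose_2)
  show ?thesis
    unfolding n by (simp add: add sq Suc_choose_2 power2_eq_square algebra_simps)
qed

section \<open>Infinite products and series as \<open>q\<close>-adic limits\<close>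

context
  fixes q :: "'a::field_char_0 fps3"
  assumes q_def: "q = var_q"
begin

lemma dvd_q_poch_inf_diff: "q ^ N dvd q_poch (z * q) q N - q_poch_inf (z * q) q"
proof -
  let ?f = "\<lambda>r. 1 - z * q * q ^ r"
  \<comment> \<open>The coefficient at \<open>i\<close> no longer changes once \<open>Suc i\<close>
    factors are present.\<close>
  define L where "L = Abs_fps (\<lambda>i. fps_nth (q_poch (z * q) q (Suc i)) i)"
  have dvd: "fps_X ^ n dvd q_poch (z * q) q n - L" for n
    unfolding fps_X_power_dvd_iff_nth
  proof (intro allI impI)
    fix i
    assume "i < n"
    then show "fps_nth (q_poch (z * q) q n - L) i = 0"
      using dvd_q_poch_diff[of "Suc i" n q z]
      unfolding q_def var_q_def fps_X_power_dvd_iff_nth by (simp add: L_def q_def var_q_def)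
  qed
  have "fps_nth L 0 = 1"
    using q_poch_var_q_nth_0[of z 1] by (simp add: L_def q_def)
  then have "L \<noteq> 0"
    by auto
  have "(\<lambda>n. q_poch (z * q) q (Suc n)) \<longlonglongrightarrow> L"
    using tendsto_fps_if_dvd[OF dvd] by (simp only: filterlim_sequentially_Suc)
  then have lim: "(\<lambda>n. \<Prod>r\<le>n. ?f r) \<longlonglongrightarrow> L"
    unfolding q_poch_def lessThan_Suc_atMost .
  \<comment> \<open>\<open>has_prod\<close> also admits the value 0 when some factor vanishes;
    excluding this makes the value in \<open>prodinf\<close> unique.\<close>
  have nz: "?f r \<noteq> 0" for r
  proof
    assume "?f r = 0"
    then have "fps_nth (?f r) 0 = 0"
      by simp
    then show False
      by (simp add: q_def var_q_def)
  qed
  have "?f has_prod L"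
    using lim \<open>L \<noteq> 0\<close> by (simp add: has_prod_def raw_has_prod_def)
  moreover have "p = L" if "?f has_prod p" for p
    using that lim nz by (auto simp: has_prod_def raw_has_prod_def intro: LIMSEQ_unique)
  ultimately have "q_poch_inf (z * q) q = L"
    unfolding q_poch_inf_def prodinf_def by (rule the_equality)
  then show ?thesis
    using dvd[of N] by (simp add: q_def var_q_def)
qed

lemma q_poch_nth_0: "fps_nth (q_poch (z * q) q n) 0 = 1" "fps_nth (q_poch q q n) 0 = 1"
  using q_poch_var_q_nth_0[of z n] q_poch_var_q_nth_0[of 1 n] by (simp_all add: q_def)

lemma q_poch_inf_nth_0: "fps_nth (q_poch_inf (z * q) q) 0 = 1"
  using dvd_q_poch_inf_diff[of 1 z] q_poch_nth_0(1)[of z 1]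
  by (simp only: q_def var_q_def fps_X_power_dvd_iff_nth) simp

text \<open>Passage from finite identities to series: \<open>E k\<close> contributes
  \<open>q ^ k\<close>, and the deviation of the Gaussian binomial times \<open>q_poch q q k\<close>
  from 1 contributes \<open>q ^ (N - k)\<close>.\<close>

lemma dvd_sum_gauss_binomial_diff:
  assumes E: "\<And>k. E k * q_poch q q k = h k" and dvd: "\<And>k. q ^ k dvd E k"
  shows "q ^ N dvd (\<Sum>k\<le>N. gauss_binomial q N k * h k) - (\<Sum>k\<le>N. E k)"
  unfolding sum_subtractf[symmetric]
proof (rule dvd_sum)
  fix k
  assume "k \<in> {..N}"
  then have k: "k \<le> N"
    by simp
  have "(gauss_binomial q N k * q_poch q q k - 1) * q_poch q q (N - k)
      = q_poch q q N - q_poch q q (N - k)"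
    using gauss_binomial_mult_q_poch[OF k, of q] by (simp add: left_diff_distrib)
  moreover have "q ^ (N - k) dvd \<dots>"
    using dvd_q_poch_diff[of "N - k" N q 1] by simp
  ultimately have "q ^ (N - k) dvd gauss_binomial q N k * q_poch q q k - 1"
    using q_poch_nth_0(2) dvd_mult_unit_cancel by metis
  with dvd have "q ^ k * q ^ (N - k) dvd E k * (gauss_binomial q N k * q_poch q q k - 1)"
    by (rule mult_dvd_mono)
  then show "q ^ N dvd gauss_binomial q N k * h k - E k"
    using k by (simp add: algebra_simps flip: E power_add)
qed

section \<open>The series of Euler and Cauchy\<close>

definition euler_term :: "'a fps3 \<Rightarrow> nat \<Rightarrow> 'a fps3" where
  "euler_term x j = x ^ j * q ^ (Suc j choose 2) / q_poch q q j"

definition cauchy_term :: "'a fps3 \<Rightarrow> nat \<Rightarrow> 'a fps3" where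
  "cauchy_term x a = x ^ a * q ^ a\<^sup>2 / (q_poch q q a * q_poch (x * q) q a)"

lemma euler_term_mult: "euler_term x j * q_poch q q j = x ^ j * q ^ (Suc j choose 2)"
  unfolding euler_term_def by (rule fps3_divide_cancel) (rule q_poch_nth_0)

lemma cauchy_term_mult:
  "cauchy_term x a * (q_poch q q a * q_poch (x * q) q a) = x ^ a * q ^ a\<^sup>2"
  unfolding cauchy_term_def by (rule fps3_divide_cancel) (simp add: q_poch_nth_0)

lemma power_dvd_euler_term: "q ^ j dvd euler_term x j"
proof (rule dvd_mult_unit_cancel)
  show "q ^ j dvd euler_term x j * q_poch q q j"
    unfolding euler_term_mult by (intro dvd_mult le_imp_power_dvd) (simp add: Suc_choose_2)
qed (rule q_poch_nth_0)

lemma power_dvd_cauchy_term: "q ^ a dvd cauchy_term x a"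
proof (rule dvd_mult_unit_cancel)
  show "q ^ a dvd cauchy_term x a * (q_poch q q a * q_poch (x * q) q a)"
    unfolding cauchy_term_mult
    by (intro dvd_mult le_imp_power_dvd) (simp add: power2_eq_square)
qed (simp add: q_poch_nth_0)

text \<open>The finite form is the \<open>q\<close>-binomial theorem at \<open>x * q\<close>, which
  raises the exponent \<open>k choose 2\<close> by \<open>k\<close>.\<close>

lemma sum_euler_term:
  "q ^ N dvd (\<Sum>j\<le>N. euler_term x j) - q_poch_inf (- x * q) q"
proof -
  have "(\<Sum>k\<le>N. gauss_binomial q N k * (x ^ k * q ^ (Suc k choose 2)))
      = (\<Sum>k\<le>N. gauss_binomial q N k * (q ^ (k choose 2) * (x * q) ^ k))"
    by (simp add: Suc_choose_2 power_add power_mult_distrib mult_ac)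
  also have "\<dots> = q_poch (- x * q) q N"
    unfolding q_binomial_theorem by simp
  finally have "q ^ N dvd q_poch (- x * q) q N - (\<Sum>j\<le>N. euler_term x j)"
    using dvd_sum_gauss_binomial_diff[of "euler_term x", OF euler_term_mult power_dvd_euler_term, of N]
    by (simp only:)
  from dvd_diff[OF dvd_q_poch_inf_diff[of N "- x"] this] show ?thesis
    by simp
qed

lemma sum_cauchy_term:
  "q ^ N dvd (\<Sum>a\<le>N. cauchy_term x a) * q_poch_inf (x * q) q - 1"
proof -
  let ?P = "q_poch (x * q) q" and ?S = "\<Sum>a\<le>N. cauchy_term x a"
  define h where "h a = cauchy_term x a * q_poch q q a" for a
  \<comment> \<open>The denominator of \<open>h a\<close> is the initial part of
    \<open>?P N\<close>; the remaining tail is the one in the finite Cauchy identity.\<close>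
  have "h a * ?P N = x ^ a * q ^ a\<^sup>2 * q_poch (x * q ^ Suc a) q (N - a)" if "a \<le> N" for a
  proof -
    have "?P N = ?P a * q_poch (x * q ^ Suc a) q (N - a)"
      using q_poch_add[of "x * q" q a "N - a"] that by (simp add: mult_ac)
    then show ?thesis
      by (simp add: h_def mult_ac flip: cauchy_term_mult)
  qed
  then have "(\<Sum>a\<le>N. gauss_binomial q N a * h a) * ?P N = 1"
    unfolding finite_Cauchy_identity[of q N x, symmetric] sum_distrib_right mult.assoc[of "gauss_binomial _ _ _"]
    by (intro sum.cong refl) simp
  moreover have "q ^ N dvd (\<Sum>a\<le>N. gauss_binomial q N a * h a) - ?S"
    by (rule dvd_sum_gauss_binomial_diff) (simp_all add: h_def power_dvd_cauchy_term)
  then have "q ^ N dvd ((\<Sum>a\<le>N. gauss_binomial q N a * h a) - ?S) * ?P N"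
    by (rule dvd_mult2)
  ultimately have "q ^ N dvd 1 - ?S * ?P N"
    by (simp only: left_diff_distrib)
  moreover have "q ^ N dvd ?S * (?P N - q_poch_inf (x * q) q)"
    by (rule dvd_mult[OF dvd_q_poch_inf_diff])
  ultimately have "q ^ N dvd - ((1 - ?S * ?P N) + ?S * (?P N - q_poch_inf (x * q) q))"
    unfolding dvd_minus_iff by (rule dvd_add)
  then show ?thesis
    by (simp add: algebra_simps)
qed

section \<open>Summation over \<open>k\<close> for fixed \<open>n\<close> and
  \<open>j\<close>\<close>

lemma summand_mult:
  fixes s y :: "'a fps3"
  assumes "a + j = n" "c \<le> j"
  shows "s * q_multinomial q n [a, j - c, c] / (q_poch (y * q) q n * q_poch q q n)
      * (q_poch q q a * q_poch q q j * q_poch (y * q) q n) = s * gauss_binomial q j c"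
    (is "?l = ?r")
proof -
  let ?p = "q_poch q q"
  define M where "M = q_multinomial q n [a, j - c, c]"
  define D where "D = q_poch (y * q) q n"
  define T where "T = s * M / (D * ?p n)"
  have M: "M * (?p a * (?p (j - c) * ?p c)) = ?p n"
    unfolding M_def q_multinomial_def list.map prod_list.Cons prod_list.Nil mult_1_right
    by (rule fps3_divide_cancel) (simp add: q_poch_nth_0)
  have T: "T * (D * ?p n) = s * M"
    unfolding T_def by (rule fps3_divide_cancel) (simp add: D_def q_poch_nth_0)
  \<comment> \<open>The extra factor \<open>?p n\<close> completes the denominator of
    \<open>T\<close>; it returns through \<open>M\<close> and is then cancelled.\<close>
  have "(T * (?p a * ?p j * D)) * ?p n = T * (D * ?p n) * (?p a * ?p j)"
    by (simp only: mult_ac)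
  also have "\<dots> = s * M * (?p a * ?p j)"
    unfolding T ..
  also have "\<dots> = s * gauss_binomial q j c * (M * (?p a * (?p (j - c) * ?p c)))"
    unfolding gauss_binomial_mult_q_poch[OF assms(2), symmetric] by (simp only: mult_ac)
  also have "\<dots> = s * gauss_binomial q j c * ?p n"
    unfolding M ..
  finally have "T * (?p a * ?p j * D) = s * gauss_binomial q j c"
    using q_poch_nth_0(2) by (rule mult_unit_cancel)
  then show ?thesis
    by (simp add: T_def M_def D_def)
qed

lemma sum_summand_eq:
  fixes x y :: "'a fps3"
  assumes "j \<le> n"
  shows "(\<Sum>k\<in>{n - j..n}. (- 1) ^ (j + k + n) * x ^ j * y ^ k
            * q ^ ((n choose 2) + (Suc k choose 2) + j ^ 2 + j - n * j)
            * q_multinomial q n [n - j, n - k, j + k - n]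
            / (q_poch (y * q) q n * q_poch q q n))
      = euler_term x j * cauchy_term y (n - j)" (is "sum ?t _ = _")
proof -
  define a where "a = n - j"
  have n: "n = a + j"
    using assms by (simp add: a_def)
  let ?p = "q_poch q q"
  let ?z = "y * q ^ Suc a"
  \<comment> \<open>The denominators of the Euler and Cauchy terms, times the tail
    \<open>q_poch ?z q j\<close> that the sum over \<open>c\<close> produces.\<close>
  let ?D = "?p a * ?p j * q_poch (y * q) q n"
  have D: "q_poch (y * q) q n = q_poch (y * q) q a * q_poch ?z q j"
    by (simp add: n q_poch_add mult_ac)
  have t: "?t (a + c) * ?D = x ^ j * q ^ (Suc j choose 2) * (y ^ a * q ^ a\<^sup>2)
      * (gauss_binomial q j c * (q ^ (c choose 2) * (- ?z) ^ c))" if "c \<le> j" for c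
  proof -
    have e: "(n choose 2) + (Suc (a + c) choose 2) + j ^ 2 + j - n * j
        = (Suc j choose 2) + a\<^sup>2 + (c choose 2) + Suc a * c"
      using exponent_eq[OF assms that] by (simp add: a_def)
    \<comment> \<open>Since \<open>a + j = n\<close>, the exponent is
      \<open>c + 2 * n\<close>.\<close>
    have sgn: "(- 1) ^ (j + (a + c) + n) = ((- 1) ^ c :: 'a fps3)"
      by (simp add: n power_add mult_ac flip: power_mult_distrib)
    have z: "(- ?z) ^ c = (- 1) ^ c * y ^ c * q ^ (Suc a * c)"
    proof -
      have "- ?z = - 1 * y * q ^ Suc a"
        by simp
      then show ?thesis
        by (simp only: power_mult_distrib power_mult)
    qed
    have ks: "[n - j, n - (a + c), j + (a + c) - n] = [a, j - c, c]"
      using that by (simp add: n)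
    define s where "s = (- 1) ^ c * x ^ j * y ^ (a + c)
      * q ^ ((Suc j choose 2) + a\<^sup>2 + (c choose 2) + Suc a * c)"
    have "?t (a + c) * ?D = s * gauss_binomial q j c"
      unfolding e sgn ks s_def by (rule summand_mult[OF n[symmetric] that])
    also have "\<dots> = x ^ j * q ^ (Suc j choose 2) * (y ^ a * q ^ a\<^sup>2)
      * (gauss_binomial q j c * (q ^ (c choose 2) * (- ?z) ^ c))"
      unfolding s_def z power_add by (simp only: mult_ac)
    finally show ?thesis .
  qed
  have "sum ?t {n - j..n} = (\<Sum>c\<le>j. ?t (a + c))"
    by (rule sum.reindex_bij_witness[of _ "\<lambda>c. a + c" "\<lambda>k. k - a"]) (auto simp: n)
  then have "sum ?t {n - j..n} * ?D = (\<Sum>c\<le>j. ?t (a + c) * ?D)"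
    by (simp only: sum_distrib_right)
  also have "\<dots> = (\<Sum>c\<le>j. x ^ j * q ^ (Suc j choose 2) * (y ^ a * q ^ a\<^sup>2)
      * (gauss_binomial q j c * (q ^ (c choose 2) * (- ?z) ^ c)))"
    by (intro sum.cong refl t) simp
  also have "\<dots> = x ^ j * q ^ (Suc j choose 2) * (y ^ a * q ^ a\<^sup>2) * q_poch ?z q j"
    unfolding sum_distrib_left[symmetric] q_binomial_theorem by simp
  also have "\<dots> = euler_term x j * cauchy_term y a * ?D"
    unfolding euler_term_mult[symmetric] cauchy_term_mult[symmetric] D by (simp only: mult_ac)
  finally have "sum ?t {n - j..n} * ?D = euler_term x j * cauchy_term y a * ?D" .
  then show ?thesis
    unfolding a_def[symmetric] by (rule mult_unit_cancel) (simp add: q_poch_nth_0)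
qed

section \<open>The Cauchy product of the two series\<close>

lemma Cauchy_product_sums:
  "(\<lambda>n. \<Sum>j\<le>n. euler_term x j * cauchy_term y (n - j))
    sums (q_poch_inf (- x * q) q / q_poch_inf (y * q) q)"
  unfolding sums_def_le
proof (rule tendsto_fps_if_dvd)
  fix N
  let ?E = "\<Sum>j\<le>N. euler_term x j" and ?C = "\<Sum>a\<le>N. cauchy_term y a"
  let ?S = "\<Sum>n\<le>N. \<Sum>j\<le>n. euler_term x j * cauchy_term y (n - j)"
  let ?P = "q_poch_inf (- x * q) q" and ?D = "q_poch_inf (y * q) q"
  have quot: "?P / ?D * ?D = ?P"
    by (rule fps3_divide_cancel) (rule q_poch_inf_nth_0)
  have "q ^ N dvd (?E * ?C - ?S) * ?D"
    by (intro dvd_mult2 dvd_Cauchy_product_diff power_dvd_euler_term power_dvd_cauchy_term)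
  moreover have "q ^ N dvd ?E * (?C * ?D - 1) + (?E - ?P)"
    by (intro dvd_add dvd_mult sum_cauchy_term sum_euler_term)
  \<comment> \<open>Multiplying by \<open>?D\<close> uses that \<open>?C * ?D\<close> is congruent
    to 1; all terms with \<open>?E\<close> cancel and \<open>?S * ?D - ?P\<close> remains.\<close>
  ultimately have "q ^ N dvd ?E * (?C * ?D - 1) + (?E - ?P) - (?E * ?C - ?S) * ?D"
    by (intro dvd_diff)
  also have "\<dots> = (?S - ?P / ?D) * ?D"
    unfolding left_diff_distrib[of ?S] quot by (simp add: left_diff_distrib right_diff_distrib mult.assoc)
  finally show "fps_X ^ N dvd ?S - ?P / ?D"
    unfolding var_q_def[symmetric] q_def[symmetric]
    by (rule dvd_mult_unit_cancel) (rule q_poch_inf_nth_0)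
qed

end

theorem theorem5:
  shows "(\<lambda>n. \<Sum>(j, k) \<in> {(j, k). j \<le> n \<and> k \<le> n \<and> n \<le> j + k}.
            (- 1) ^ (j + k + n) * var_t1 ^ j * var_t2 ^ k
            * var_q ^ ((n choose 2) + (Suc k choose 2) + j ^ 2 + j - n * j)
            * q_multinomial var_q n [n - j, n - k, j + k - n]
            / (q_poch (var_t2 * var_q) var_q n * q_poch var_q var_q n))
         sums
         (q_poch_inf (- var_t1 * var_q) var_q / q_poch_inf (var_t2 * var_q) var_q
           :: 'a::field_char_0 fps3)"
proof -
  have idx: "{(j, k). j \<le> n \<and> k \<le> n \<and> n \<le> j + k} = (SIGMA j:{..n}. {n - j..n})" for n :: nat
    by auto
  have "(\<Sum>(j, k) \<in> {(j, k). j \<le> n \<and> k \<le> n \<and> n \<le> j + k}.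
            (- 1) ^ (j + k + n) * var_t1 ^ j * var_t2 ^ k
            * var_q ^ ((n choose 2) + (Suc k choose 2) + j ^ 2 + j - n * j)
            * q_multinomial var_q n [n - j, n - k, j + k - n]
            / (q_poch (var_t2 * var_q) var_q n * q_poch var_q var_q n))
      = (\<Sum>j\<le>n. euler_term var_q var_t1 j * cauchy_term var_q (var_t2 :: 'a fps3) (n - j))" for n
    unfolding idx
    by (subst sum.Sigma[symmetric]) (auto intro!: sum.cong sum_summand_eq[OF refl])
  then show ?thesis
    \<comment> \<open>\<open>refl\<close> instantiates the fixed \<open>q\<close> of the context to
      \<open>var_q\<close>.\<close>
    using Cauchy_product_sums[OF refl, of var_t1 var_t2] by (simp only:)
qed

end
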